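(* Let $q$ be a prime power, let $n,k,\ell$ be positive integers with $k<n$, put $r:=n-k$, and assume $r\ge 3$ and $\ell\ge 2$. Then for every $(n,k,\ell)$ MDS array code $\mathcal{C}$ over $\mathbb{F}_q$, each of the four quantities $\beta_{\mathrm{avg}}(\mathcal{C})$, $\beta_{\max}(\mathcal{C})$, $\gamma_{\mathrm{avg}}(\mathcal{C})$, $\gamma_{\max}(\mathcal{C})$ (average and worst-case repair bandwidth, average and worst-case repair I/O, under linear exact repair) is strictly greater than $$\ell(n-1)-\frac{q^{(r-1)\ell}-1}{q-1}.$$
   Context: Write $[n]=\{1,\dots,n\}$. An $(n,k,\ell)$ linear array code over $\mathbb{F}_q$ is an $\mathbb{F}_q$-subspace $\mathcal{C}\le(\mathbb{F}_q^\ell)^n$ of dimension $k\ell$; here $1\le k<n$ and $r:=n-k$. It is described by a block parity-check matrix $H=[H_1\ H_2\ \cdots\ H_n]\in\mathbb{F}_q^{r\ell\times n\ell}$ of full row rank $r\ell$, with $H_i\in\mathbb{F}_q^{r\ell\times\ell}$, so that $\mathcal{C}=\{(C_1,\dots,C_n)\in(\mathbb{F}_q^\ell)^n:\sum_{i=1}^n H_iC_i=0\}$. The code is MDS if for every $I\subseteq[n]$ with $|I|=r$ the square matrix $[H_i]_{i\in I}\in\mathbb{F}_q^{r\ell\times r\ell}$ is invertible. For $i\in[n]$ let $\mathcal{M}_i=\{M\in\mathbb{F}_q^{\ell\times r\ell}: MH_i\text{ is invertible}\}$ (the linear repair matrices for node $i$). For $M\in\mathcal{M}_i$ put $\mathrm{BW}_i(M)=\sum_{j\ne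 i}\mathrm{rank}(MH_j)$ and $\mathrm{IO}_i(M)=\sum_{j\ne i}\mathrm{nz}(MH_j)$, where $\mathrm{nz}(A)$ is the number of nonzero columns of $A$. Define $\beta_i(\mathcal{C})=\min_{M\in\mathcal{M}_i}\mathrm{BW}_i(M)$, $\gamma_i(\mathcal{C})=\min_{M\in\mathcal{M}_i}\mathrm{IO}_i(M)$, and $\beta_{\mathrm{avg}}(\mathcal{C})=\frac1n\sum_{i=1}^n\beta_i(\mathcal{C})$, $\beta_{\max}(\mathcal{C})=\max_{i\in[n]}\beta_i(\mathcal{C})$, $\gamma_{\mathrm{avg}}(\mathcal{C})=\frac1n\sum_{i=1}^n\gamma_i(\mathcal{C})$, $\gamma_{\max}(\mathcal{C})=\max_{i\in[n]}\gamma_i(\mathcal{C})$. (These do not depend on the choice of $H$, since $H$ is determined by $\mathcal{C}$ up to left multiplication by an invertible matrix.) *)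

theory Defs
  imports
    "Jordan_Normal_Form.DL_Rank"
    "Jordan_Normal_Form.DL_Submatrix"
    "Jordan_Normal_Form.Matrix_Kernel"
    "HOL-Library.Cardinality"
begin

(* Nodes are numbered 0, ..., n - 1.  The space of n-tuples of vectors of length l is identified
   with the vectors of length n * l: block i consists of the coordinates j with j div l = i.  A block
   matrix [H_0 ... H_{n-1}] with blocks of width l is accordingly a matrix with n * l columns, and
   the sum of the H_i C_i is the ordinary matrix-vector product. *)

definition array_code :: "nat \<Rightarrow> nat \<Rightarrow> nat \<Rightarrow> 'a::field vec set \<Rightarrow> bool" where
  "array_code n k l C \<longleftrightarrow>
     VectorSpace.subspace class_ring C (module_vec TYPE('a) (n * l)) \<and>
     vectorspace.dim class_ring ((module_vec TYPE('a) (n * l))\<lparr>carrier := C\<rparr>) = k * l"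

definition parity_check_matrix ::
    "nat \<Rightarrow> nat \<Rightarrow> nat \<Rightarrow> 'a::field vec set \<Rightarrow> 'a mat \<Rightarrow> bool" where
  "parity_check_matrix n k l C H \<longleftrightarrow>
     H \<in> carrier_mat ((n - k) * l) (n * l) \<and>
     vec_space.rank ((n - k) * l) H = (n - k) * l \<and>
     C = mat_kernel H"

(* The matrix formed by the blocks H_i, i in I, in increasing order of i. *)
definition blocks :: "nat \<Rightarrow> 'a mat \<Rightarrow> nat set \<Rightarrow> 'a mat" where
  "blocks l H I = submatrix H UNIV {j. j div l \<in> I}"

abbreviation block :: "nat \<Rightarrow> 'a mat \<Rightarrow> nat \<Rightarrow> 'a mat" where
  "block l H i \<equiv> blocks l H {i}"

definition mds :: "nat \<Rightarrow> nat \<Rightarrow> nat \<Rightarrow> 'a::field mat \<Rightarrow> bool" where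
  "mds n k l H \<longleftrightarrow>
     (\<forall>I. I \<subseteq> {..<n} \<and> card I = n - k \<longrightarrow> invertible_mat (blocks l H I))"

definition repair_matrices :: "nat \<Rightarrow> nat \<Rightarrow> nat \<Rightarrow> 'a::field mat \<Rightarrow> nat \<Rightarrow> 'a mat set" where
  "repair_matrices n k l H i =
     {M \<in> carrier_mat l ((n - k) * l). invertible_mat (M * block l H i)}"

definition nz :: "'a::zero mat \<Rightarrow> nat" where
  "nz A = card {j. j < dim_col A \<and> col A j \<noteq> 0\<^sub>v (dim_row A)}"

definition BW :: "nat \<Rightarrow> nat \<Rightarrow> 'a::field mat \<Rightarrow> nat \<Rightarrow> 'a mat \<Rightarrow> nat" where
  "BW n l H i M = (\<Sum>j\<in>{..<n} - {i}. vec_space.rank l (M * block l H j))"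

definition IO :: "nat \<Rightarrow> nat \<Rightarrow> 'a::field mat \<Rightarrow> nat \<Rightarrow> 'a mat \<Rightarrow> nat" where
  "IO n l H i M = (\<Sum>j\<in>{..<n} - {i}. nz (M * block l H j))"

(* As in the literature, the following quantities belong to the code: they do not depend on the
   choice of its parity-check matrix H, through which they are computed. *)

definition beta :: "nat \<Rightarrow> nat \<Rightarrow> nat \<Rightarrow> 'a::field mat \<Rightarrow> nat \<Rightarrow> nat" where
  "beta n k l H i = Min (BW n l H i ` repair_matrices n k l H i)"

definition gamma :: "nat \<Rightarrow> nat \<Rightarrow> nat \<Rightarrow> 'a::field mat \<Rightarrow> nat \<Rightarrow> nat" where
  "gamma n k l H i = Min (IO n l H i ` repair_matrices n k l H i)"

definition beta_avg :: "nat \<Rightarrow> nat \<Rightarrow> nat \<Rightarrow> 'a::field mat \<Rightarrow> real" where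
  "beta_avg n k l H = (\<Sum>i<n. real (beta n k l H i)) / real n"

definition beta_max :: "nat \<Rightarrow> nat \<Rightarrow> nat \<Rightarrow> 'a::field mat \<Rightarrow> nat" where
  "beta_max n k l H = Max (beta n k l H ` {..<n})"

definition gamma_avg :: "nat \<Rightarrow> nat \<Rightarrow> nat \<Rightarrow> 'a::field mat \<Rightarrow> real" where
  "gamma_avg n k l H = (\<Sum>i<n. real (gamma n k l H i)) / real n"

definition gamma_max :: "nat \<Rightarrow> nat \<Rightarrow> nat \<Rightarrow> 'a::field mat \<Rightarrow> nat" where
  "gamma_max n k l H = Max (gamma n k l H ` {..<n})"

end

theory Submission
  imports Defs "Berlekamp_Zassenhaus.Berlekamp_Type_Based"
begin

text \<open>
  Let $K$ be the kernel of a repair matrix $M$ for node $i$ and let $V_j$ be the column space of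
  $H_j$.  By the MDS property any $r$ of the $V_j$ are independent, so for $j \neq i$ the subspaces
  $V_j \cap K$, of dimension $d_j = \ell - \mathrm{rank}(M H_j)$, meet pairwise trivially inside $K$,
  which has $q^{(r-1)\ell}$ elements.  Counting nonzero vectors and using $d (q-1) \le q^d - 1$ gives
  $(q-1) \sum_j d_j \le q^{(r-1)\ell} - 1$.  Equality is impossible: if two of the subspaces are
  nonzero, then, since $r \ge 3$, a sum of nonzero vectors of these two lies in $K$ but in none of the
  $V_j$; otherwise $\sum_j d_j \le \ell$, which is too small.  The bound for the repair I/O follows, as
  the rank of a matrix is at most its number of nonzero columns.
\<close>

section \<open>Counting over a finite field: images, kernels and rank\<close>

lemma finite_carrier_mat: "finite (carrier_mat nr nc :: 'a::finite mat set)"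
proof -
  have "A \<in> mat nr nc ` (({..<nr} \<times> {..<nc}) \<rightarrow>\<^sub>E UNIV)" if "A \<in> carrier_mat nr nc" for A :: "'a mat"
  proof
    show "A = mat nr nc (restrict (($$) A) ({..<nr} \<times> {..<nc}))"
      using that by (intro eq_matI) auto
  qed auto
  then show ?thesis
    by (rule finite_subset[of _ "mat nr nc ` (({..<nr} \<times> {..<nc}) \<rightarrow>\<^sub>E UNIV)", OF subsetI])
      (auto intro!: finite_imageI finite_PiE)
qed

text \<open>Rank-nullity in counting form. Once a preimage \<open>?s y\<close> of every value
  \<open>y\<close> is fixed, each vector splits uniquely into some \<open>?s y\<close> and a kernel
  vector. Working with cardinalities avoids any passage through dimensions of subspaces.\<close>

lemma card_image_mult_card_kernel:
  fixes A :: "'a::{field,finite} mat"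
  assumes A: "A \<in> carrier_mat nr nc"
  shows "card ((*\<^sub>v) A ` carrier_vec nc) * card (mat_kernel A) = CARD('a) ^ nc"
proof -
  let ?X = "carrier_vec nc :: 'a vec set" and ?f = "(*\<^sub>v) A"
  let ?s = "inv_into ?X ?f"
  have s: "?s y \<in> ?X" "A *\<^sub>v ?s y = y" if "y \<in> ?f ` ?X" for y
    using that by (auto intro: inv_into_into f_inv_into_f)
  have ker: "z \<in> mat_kernel A \<longleftrightarrow> z \<in> ?X \<and> A *\<^sub>v z = 0\<^sub>v nr" for z
    by (simp add: mat_kernel[OF A])
  have "bij_betw (\<lambda>(y, z). ?s y + z) (?f ` ?X \<times> mat_kernel A) ?X"
  proof (rule bij_betw_byWitness[where f' = "\<lambda>x. (A *\<^sub>v x, x - ?s (A *\<^sub>v x))"])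
    have val: "A *\<^sub>v (?s y + z) = y" if "y \<in> ?f ` ?X" "z \<in> mat_kernel A" for y z
    proof -
      have "A *\<^sub>v (?s y + z) = A *\<^sub>v ?s y + A *\<^sub>v z"
        using A that s(1) by (intro mult_add_distrib_mat_vec) (auto simp: ker)
      then show ?thesis
        using s(2)[OF that(1)] that A by (auto simp: ker)
    qed
    show "\<forall>a\<in>?f ` ?X \<times> mat_kernel A. (\<lambda>x. (A *\<^sub>v x, x - ?s (A *\<^sub>v x))) ((\<lambda>(y, z). ?s y + z) a) = a"
    proof
      fix a assume "a \<in> ?f ` ?X \<times> mat_kernel A"
      then obtain y z where a: "a = (y, z)" and y: "y \<in> ?f ` ?X" and z: "z \<in> mat_kernel A"
        by blast
      have "?s y + z - ?s y = z"
        using s(1)[OF y] z by (intro eq_vecI) (auto simp: ker)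
      then show "(\<lambda>x. (A *\<^sub>v x, x - ?s (A *\<^sub>v x))) ((\<lambda>(y, z). ?s y + z) a) = a"
        by (simp only: a prod.case val[OF y z])
    qed
    show "\<forall>a'\<in>?X. (\<lambda>(y, z). ?s y + z) (A *\<^sub>v a', a' - ?s (A *\<^sub>v a')) = a'"
    proof
      fix x assume x: "x \<in> ?X"
      have "?s (A *\<^sub>v x) \<in> ?X" using s(1) x by blast
      then show "(\<lambda>(y, z). ?s y + z) (A *\<^sub>v x, x - ?s (A *\<^sub>v x)) = x"
        using x by (auto intro!: eq_vecI)
    qed
    show "(\<lambda>(y, z). ?s y + z) ` (?f ` ?X \<times> mat_kernel A) \<subseteq> ?X"
      using s(1) by (auto simp: ker)
    show "(\<lambda>x. (A *\<^sub>v x, x - ?s (A *\<^sub>v x))) ` ?X \<subseteq> ?f ` ?X \<times> mat_kernel A"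
    proof (rule image_subsetI)
      fix x assume x: "x \<in> ?X"
      have sx: "?s (A *\<^sub>v x) \<in> ?X" "A *\<^sub>v ?s (A *\<^sub>v x) = A *\<^sub>v x" using s x by blast+
      have "A *\<^sub>v (x - ?s (A *\<^sub>v x)) = 0\<^sub>v nr"
        using mult_minus_distrib_mat_vec[OF A x sx(1)] A x sx(2) by auto
      then show "(A *\<^sub>v x, x - ?s (A *\<^sub>v x)) \<in> ?f ` ?X \<times> mat_kernel A"
        using x sx(1) by (auto simp: ker)
    qed
  qed
  from bij_betw_same_card[OF this] show ?thesis
    by (simp add: card_cartesian_product card_carrier_vec)
qed

context vec_space
begin

text \<open>A maximal independent set of columns will do: a column outside its span could be
  adjoined, against maximality.\<close>

lemma rank_basis:
  assumes A: "A \<in> carrier_mat n nc"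
  obtains U where "U \<subseteq> set (cols A)" "lin_indpt U" "rank A = card U" "set (cols A) \<subseteq> span U"
proof -
  let ?P = "\<lambda>T. T \<subseteq> set (cols A) \<and> lin_indpt T"
  have carr: "set (cols A) \<subseteq> carrier_vec n"
    using cols_dim[of A] A by auto
  have "lin_indpt {}" by (auto simp: lin_dep_def)
  then obtain U where U: "maximal U ?P"
    using maximal_exists_superset[of "set (cols A)" ?P "{}"] by auto
  then have PU: "?P U" by (simp add: maximal_def)
  have UV: "U \<subseteq> carrier_vec n" using PU carr by blast
  have "c \<in> span U" if c: "c \<in> set (cols A)" for c
  proof (rule ccontr)
    assume n: "c \<notin> span U"
    have cU: "c \<notin> U" using n in_own_span[OF UV] by blast
    have "lin_indpt (U \<union> {c})"
      using lin_dep_iff_in_span[OF UV _ _ cU] PU c carr n by blast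
    then have "U \<union> {c} = U"
      using U PU c unfolding maximal_def by blast
    then show False using cU by blast
  qed
  then show ?thesis
    using that PU rank_card_indpt[OF A U] by blast
qed

text \<open>An independent set omits the zero vector, so a basis chosen among the columns consists
  of nonzero columns.\<close>

lemma rank_le_nz:
  assumes A: "A \<in> carrier_mat n nc"
  shows "rank A \<le> nz A"
proof -
  obtain U where U: "U \<subseteq> set (cols A)" "lin_indpt U" "rank A = card U" "set (cols A) \<subseteq> span U"
    by (rule rank_basis[OF A])
  have carr: "set (cols A) \<subseteq> carrier_vec n"
    using cols_dim[of A] A by auto
  \<comment> \<open>Over the trivial ring even a set containing zero is independent, so
    nontriviality of the scalars has to be supplied.\<close>
  have "(UNIV :: 'a set) \<noteq> {0}"
    using zero_neq_one by (metis UNIV_I singletonD)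
  then have "0\<^sub>v n \<notin> U"
    using zero_nin_lin_indpt[of U] U carr by auto
  then have "U \<subseteq> col A ` {j. j < dim_col A \<and> col A j \<noteq> 0\<^sub>v (dim_row A)}"
    using U(1) A by (fastforce simp: cols_def)
  then have "card U \<le> card (col A ` {j. j < dim_col A \<and> col A j \<noteq> 0\<^sub>v (dim_row A)})"
    by (intro card_mono) auto
  also have "\<dots> \<le> nz A"
    unfolding nz_def by (intro card_image_le) auto
  finally show ?thesis using U by simp
qed

end

text \<open>The image lies in the span of a basis \<open>U\<close> taken from the columns, and a
  linear combination is determined by its coefficients on \<open>U\<close>, of which there are q^|U|
  choices.\<close>

lemma card_image_le_power_rank:
  fixes A :: "'a::{field,finite} mat"
  assumes A: "A \<in> carrier_mat nr nc"
  shows "card ((*\<^sub>v) A ` carrier_vec nc) \<le> CARD('a) ^ vec_space.rank nr A"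
proof -
  interpret vec_space "TYPE('a)" nr .
  obtain U where U: "U \<subseteq> set (cols A)" "lin_indpt U" "rank A = card U" "set (cols A) \<subseteq> span U"
    by (rule rank_basis[OF A])
  have fin: "finite U" using U(1) finite_subset by auto
  have UV: "U \<subseteq> carrier_vec nr"
    using U(1) cols_dim[of A] A by auto
  have "(*\<^sub>v) A ` carrier_vec nc \<subseteq> span (set (cols A))"
    using col_space_eq[OF A] A unfolding col_space_def by auto
  also have "\<dots> \<subseteq> span U"
    using span_is_subset[OF U(4) span_is_submodule[OF UV]] .
  also have "\<dots> \<subseteq> (\<lambda>a. lincomb a U) ` (U \<rightarrow>\<^sub>E UNIV)"
  proof
    fix x assume "x \<in> span U"
    then obtain a where "x = lincomb a U"
      using finite_span[OF fin UV] by auto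
    also have "\<dots> = lincomb (restrict a U) U"
      using UV by (intro lincomb_cong) auto
    finally show "x \<in> (\<lambda>a. lincomb a U) ` (U \<rightarrow>\<^sub>E UNIV)" by auto
  qed
  finally have "card ((*\<^sub>v) A ` carrier_vec nc) \<le> card ((\<lambda>a. lincomb a U) ` (U \<rightarrow>\<^sub>E (UNIV :: 'a set)))"
    using fin by (intro card_mono finite_imageI finite_PiE) auto
  also have "\<dots> \<le> card (U \<rightarrow>\<^sub>E (UNIV :: 'a set))"
    using fin by (intro card_image_le finite_PiE) auto
  also have "\<dots> = CARD('a) ^ rank A"
    using fin U(3) by (simp add: card_PiE)
  finally show ?thesis .
qed

text \<open>An upper bound for the image is a lower bound for the kernel. In this form the rank of M
  H_j enters the repair bound.\<close>

lemma power_le_power_rank_mult_card_kernel: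
  fixes A :: "'a::{field,finite} mat"
  assumes A: "A \<in> carrier_mat nr nc"
  shows "CARD('a) ^ nc \<le> CARD('a) ^ vec_space.rank nr A * card (mat_kernel A)"
  using card_image_mult_card_kernel[OF A] card_image_le_power_rank[OF A] by (metis mult_le_mono1)

section \<open>Column positions in block matrices, and separation of nodes by the MDS
  property\<close>

lemma div_block_index:
  fixes a t l :: nat
  assumes "t < l"
  shows "(a * l + t) div l = a"
  using assms by simp

lemma block_index_less:
  fixes a t l n :: nat
  assumes "a < n" "t < l"
  shows "a * l + t < n * l"
proof -
  have "a * l + t < (a + 1) * l" using assms by simp
  also have "\<dots> \<le> n * l" using assms by (intro mult_le_mono1) simp
  finally show ?thesis .
qed

text \<open>Selection keeps the order of the columns, so a selected column of \<open>H\<close> lands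
  at the position given by the number of selected columns before it.\<close>

lemma blocks_index:
  assumes H: "H \<in> carrier_mat m (n * l)" and "a \<in> I" "a < n" "t < l" "s < m"
  defines "p \<equiv> card {j \<in> {j. j div l \<in> I}. j < a * l + t}"
  shows "p < dim_col (blocks l H I)" and "blocks l H I $$ (s, p) = H $$ (s, a * l + t)"
proof -
  have lt: "a * l + t < n * l" using assms by (intro block_index_less)
  have mem: "a * l + t \<in> {j. j div l \<in> I}" using assms by simp
  \<comment> \<open>The inclusion is strict because the column itself is selected but does not
    precede itself.\<close>
  have "{j \<in> {j. j div l \<in> I}. j < a * l + t} \<subset> {j. j < n * l \<and> j \<in> {j. j div l \<in> I}}"
    using lt mem by auto
  then show "p < dim_col (blocks l H I)"
    using H unfolding blocks_def p_def dim_submatrix by (intro psubset_card_mono) auto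
  show "blocks l H I $$ (s, p) = H $$ (s, a * l + t)"
    using submatrix_index_card[of s H "a * l + t" UNIV "{j. j div l \<in> I}"] H lt mem \<open>s < m\<close>
    unfolding blocks_def p_def by simp
qed

lemma block_carrier:
  assumes H: "H \<in> carrier_mat m (n * l)" and "a < n" "0 < l"
  shows "block l H a \<in> carrier_mat m l"
proof -
  have "{j. j < n * l \<and> j div l = a} = {a * l..<a * l + l}"
  proof (intro subset_antisym subsetI)
    fix j assume "j \<in> {j. j < n * l \<and> j div l = a}"
    then show "j \<in> {a * l..<a * l + l}"
      using dividend_less_div_times[OF \<open>0 < l\<close>, of j] by (auto simp: add.commute)
  next
    fix j assume j: "j \<in> {a * l..<a * l + l}"
    then obtain t where "j = a * l + t" "t < l"
      by (metis add_less_cancel_left atLeastLessThan_iff le_Suc_ex)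
    then show "j \<in> {j. j < n * l \<and> j div l = a}"
      using block_index_less[OF \<open>a < n\<close>] by auto
  qed
  then have "card {j. j < n * l \<and> j div l = a} = l" by simp
  then show ?thesis
    using carrier_matD[OF H] unfolding blocks_def
    by (intro carrier_matI) (simp_all only: dim_submatrix UNIV_I simp_thms singleton_iff
        mem_Collect_eq card_Collect_less_nat)
qed

lemma block_index:
  assumes H: "H \<in> carrier_mat m (n * l)" and "a < n" "t < l" "s < m"
  shows "block l H a $$ (s, t) = H $$ (s, a * l + t)"
proof -
  have "{j \<in> {j. j div l \<in> {a}}. j < a * l + t} = {a * l..<a * l + t}"
  proof (intro subset_antisym subsetI)
    fix j assume "j \<in> {j \<in> {j. j div l \<in> {a}}. j < a * l + t}"
    then show "j \<in> {a * l..<a * l + t}" by auto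
  next
    fix j assume j: "j \<in> {a * l..<a * l + t}"
    then obtain u where "j = a * l + u" "u < l"
      using \<open>t < l\<close> by (metis add_less_cancel_left atLeastLessThan_iff le_Suc_ex less_trans)
    then show "j \<in> {j \<in> {j. j div l \<in> {a}}. j < a * l + t}"
      using j by auto
  qed
  then have "card {j \<in> {j. j div l \<in> {a}}. j < a * l + t} = t" by simp
  then show ?thesis
    using blocks_index(2)[of H m n l a "{a}" t s] assms by simp
qed

text \<open>The matrices $P_a$ are groups of $\ell$ rows of the inverse of $[H_i]_{i \in I}$, for some
  $I \supseteq J$ of cardinality $n - k$.\<close>
lemma mds_separating_matrices:
  fixes H :: "'a::field mat"
  assumes H: "H \<in> carrier_mat ((n - k) * l) (n * l)" and mds: "mds n k l H"
    and l: "0 < l" and J: "J \<subseteq> {..<n}" "card J \<le> n - k"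
  obtains P where "\<And>a. P a \<in> carrier_mat l ((n - k) * l)"
    "\<And>a b. a \<in> J \<Longrightarrow> b \<in> J \<Longrightarrow> P a * block l H b = (if a = b then 1\<^sub>m l else 0\<^sub>m l l)"
proof -
  let ?m = "(n - k) * l"
  obtain I where I: "J \<subseteq> I" "I \<subseteq> {..<n}" "card I = n - k"
    using exists_subset_between[of J "n - k" "{..<n}"] J by auto
  let ?A = "blocks l H I"
  let ?S = "{j. j div l \<in> I}"
  define pos where "pos j = card {i \<in> ?S. i < j}" for j
  have "invertible_mat ?A" using mds I unfolding mds_def by blast
  then obtain B where sq: "dim_row ?A = dim_col ?A" and AB: "?A * B = 1\<^sub>m (dim_row ?A)"
    and BA: "B * ?A = 1\<^sub>m (dim_row B)"
    unfolding invertible_mat_def inverts_mat_def by auto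
  have row: "dim_row ?A = ?m" using H unfolding blocks_def by (simp add: dim_submatrix)
  have colA: "dim_col ?A = ?m" using sq row by simp
  \<comment> \<open>\<open>invertible_mat\<close> does not state the size of the inverse; it is read
    off by comparing column counts in the two identities.\<close>
  have B: "dim_row B = ?m" "dim_col B = ?m"
    using arg_cong[OF BA, of dim_col] arg_cong[OF AB, of dim_col] row colA by auto
  \<comment> \<open>\<open>pick ?S\<close> inverts \<open>pos\<close> on \<open>?S\<close>, so
    distinct selected columns occupy distinct positions.\<close>
  have "pick ?S (pos j) = j" if "j \<in> ?S" for j
    unfolding pos_def using that by (rule pick_card_in_set)
  then have inj: "pos i = pos j \<longleftrightarrow> i = j" if "i \<in> ?S" "j \<in> ?S" for i j
    using that by metis
  define P where "P a = mat l ?m (\<lambda>(t, s). B $$ (pos (a * l + t), s))" for a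
  show ?thesis
  proof (rule that[of P])
    show "P a \<in> carrier_mat l ?m" for a by (simp add: P_def)
    fix a b assume ab: "a \<in> J" "b \<in> J"
    have abI: "a \<in> I" "b \<in> I" "a < n" "b < n" using ab I by auto
    have carr: "block l H b \<in> carrier_mat ?m l" using block_carrier[OF H abI(4) l] .
    have "k < n" using I abI by (metis card_gt_0_iff empty_iff finite_lessThan finite_subset zero_less_diff)
    \<comment> \<open>This provides the row index 0 at which \<open>blocks_index\<close> is
      instantiated below.\<close>
    then have m0: "0 < ?m" using l by simp
    show "P a * block l H b = (if a = b then 1\<^sub>m l else 0\<^sub>m l l)"
    proof (rule eq_matI)
      fix t u assume "t < dim_row (if a = b then 1\<^sub>m l else 0\<^sub>m l l :: 'a mat)"
        "u < dim_col (if a = b then 1\<^sub>m l else 0\<^sub>m l l :: 'a mat)"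
      then have tu: "t < l" "u < l" by (auto split: if_splits)
      have p: "pos (a * l + t) < ?m" "pos (b * l + u) < ?m"
        using blocks_index(1)[OF H abI(1,3) tu(1) m0] blocks_index(1)[OF H abI(2,4) tu(2) m0]
        unfolding colA pos_def by auto
      have "(P a * block l H b) $$ (t, u)
          = (\<Sum>s<?m. B $$ (pos (a * l + t), s) * H $$ (s, b * l + u))"
        using tu carr by (auto simp: P_def scalar_prod_def block_index[OF H abI(4) tu(2)]
            atLeast0LessThan intro!: sum.cong)
      \<comment> \<open>Column \<open>b * l + u\<close> of \<open>H\<close> is the column of
        \<open>?A\<close> at position \<open>pos (b * l + u)\<close>, so the sum is an entry of the
        identity matrix.\<close>
      also have "\<dots> = (B * ?A) $$ (pos (a * l + t), pos (b * l + u))"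
        using p B row colA blocks_index(2)[OF H abI(2,4) tu(2), folded pos_def]
        by (simp add: scalar_prod_def atLeast0LessThan)
      also have "\<dots> = (if a * l + t = b * l + u then 1 else 0)"
        using p B tu abI by (simp add: BA inj)
      also have "a * l + t = b * l + u \<longleftrightarrow> a = b \<and> t = u"
        using tu div_block_index by (metis add_left_cancel)
      finally show "(P a * block l H b) $$ (t, u)
          = (if a = b then 1\<^sub>m l else 0\<^sub>m l l) $$ (t, u)"
        using tu by auto
    qed (use carr in \<open>auto simp: P_def\<close>)
  qed
qed

section \<open>The bound for a single repair matrix\<close>

text \<open>Bernoulli's inequality for (1 + (q - 1))^d. It converts a count of nonzero vectors into
  a bound that is linear in the dimension and can be summed over the nodes.\<close>

lemma power_ge_linear:
  fixes q d :: nat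
  assumes "2 \<le> q"
  shows "real d * (real q - 1) \<le> real q ^ d - 1"
  using Bernoulli_inequality[of "real q - 1" d] assms by (simp add: algebra_simps)

text \<open>Only $|\ker(M H_j)| \ge q^{\ell - m_j}$ matters for the cost $m_j$ of node $j$.\<close>
lemma repair_cost_lower_bound:
  fixes H :: "'a::{field,finite} mat" and m :: "nat \<Rightarrow> nat"
  defines "q \<equiv> CARD('a)"
  assumes H: "H \<in> carrier_mat ((n - k) * l) (n * l)" and mds: "mds n k l H"
    and r: "3 \<le> n - k" and l: "0 < l" and i: "i < n"
    and M: "M \<in> repair_matrices n k l H i"
    and m: "\<And>j. j < n \<Longrightarrow> j \<noteq> i \<Longrightarrow> q ^ l \<le> q ^ m j * card (mat_kernel (M * block l H j))"
  shows "real l * (real n - 1) - (real q ^ ((n - k - 1) * l) - 1) / (real q - 1)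
    < real (\<Sum>j\<in>{..<n} - {i}. m j)"
proof -
  let ?r = "n - k"
  let ?N = "{..<n} - {i}"
  define K where "K = mat_kernel M"
  \<comment> \<open>\<open>W j\<close> is the preimage of \<open>K\<close> under H_j. As H_j is
    injective by the MDS property, \<open>E j\<close> is the set of nonzero vectors of V_j \<inter>
    K.\<close>
  define W where "W j = mat_kernel (M * block l H j)" for j
  define E where "E j = (*\<^sub>v) (block l H j) ` (W j - {0\<^sub>v l})" for j
  \<comment> \<open>Natural subtraction: \<open>d j\<close> is 0 if \<open>m j\<close> exceeds
    \<open>l\<close>, so that \<open>l \<le> m j + d j\<close> holds in every case.\<close>
  define d where "d j = l - m j" for j
  have "card {0, 1 :: 'a} \<le> q" unfolding q_def by (intro card_mono) auto
  then have q: "2 \<le> q" by simp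
  have Mc: "M \<in> carrier_mat l (?r * l)" and MH: "invertible_mat (M * block l H i)"
    using M by (auto simp: repair_matrices_def)
  have bc: "block l H j \<in> carrier_mat (?r * l) l" if "j < n" for j
    using block_carrier[OF H that l] .
  have W: "y \<in> W j \<longleftrightarrow> y \<in> carrier_vec l \<and> M *\<^sub>v (block l H j *\<^sub>v y) = 0\<^sub>v l" if "j < n" for j y
  proof -
    have "M * block l H j \<in> carrier_mat l l" using Mc bc[OF that] by (rule mult_carrier_mat)
    from mat_kernel[OF this] show ?thesis
      unfolding W_def using assoc_mult_mat_vec[OF Mc bc[OF that]] by fastforce
  qed
  have K: "x \<in> K \<longleftrightarrow> x \<in> carrier_vec (?r * l) \<and> M *\<^sub>v x = 0\<^sub>v l" for x
    using mat_kernel[OF Mc] by (auto simp: K_def)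
  have finK: "finite K" by (rule finite_subset[of _ "carrier_vec (?r * l)"]) (auto simp: K)
  have finW: "finite (W j)" if "j < n" for j
    by (rule finite_subset[of _ "carrier_vec l"]) (auto simp: W[OF that])
  have "(*\<^sub>v) M ` carrier_vec (?r * l) = carrier_vec l"
  \<comment> \<open>With \<open>B\<close> the inverse of M H_i, every \<open>y\<close> equals M (H_i
    (B y)), so \<open>M\<close> is onto. This fixes the size of \<open>K\<close> exactly.\<close>
  proof (intro subset_antisym subsetI)
    fix y :: "'a vec" assume y: "y \<in> carrier_vec l"
    have c: "M * block l H i \<in> carrier_mat l l" using Mc bc[OF i] by (rule mult_carrier_mat)
    from MH obtain B where B: "M * block l H i * B = 1\<^sub>m l" "B * (M * block l H i) = 1\<^sub>m (dim_row B)"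
      using carrier_matD(1)[OF c] unfolding invertible_mat_def inverts_mat_def by metis
    have Bc: "B \<in> carrier_mat l l"
      using arg_cong[OF B(1), of dim_col] arg_cong[OF B(2), of dim_col] carrier_matD(2)[OF c]
      by (intro carrier_matI) (simp_all del: assoc_mult_mat)
    have "y = (M * block l H i * B) *\<^sub>v y" using y B by simp
    also have "\<dots> = M *\<^sub>v (block l H i *\<^sub>v (B *\<^sub>v y))"
      using y by (simp only: assoc_mult_mat_vec[OF c Bc] assoc_mult_mat_vec[OF Mc bc[OF i]]
          mult_mat_vec_carrier[OF Bc])
    finally have "y = M *\<^sub>v (block l H i *\<^sub>v (B *\<^sub>v y))" .
    moreover have "block l H i *\<^sub>v (B *\<^sub>v y) \<in> carrier_vec (?r * l)"
      using bc[OF i] Bc y by simp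
    ultimately show "y \<in> (*\<^sub>v) M ` carrier_vec (?r * l)" by blast
  qed (use Mc in auto)
  then have "q ^ l * card K = q ^ (?r * l)"
    using card_image_mult_card_kernel[OF Mc] by (simp add: K_def q_def card_carrier_vec)
  also have "?r * l = l + (?r - 1) * l"
    using r by (metis Suc_diff_1 less_le_trans mult_Suc zero_less_numeral)
  finally have cardK: "card K = q ^ ((?r - 1) * l)"
    using q by (simp add: power_add)
  \<comment> \<open>\<open>P a\<close> extracts the component of node \<open>a\<close> from a sum of
    vectors of the V_b with \<open>b\<close> in \<open>J\<close>. Sets \<open>J\<close> of one, two
    and three nodes will give injectivity of H_j, disjointness of the \<open>E j\<close>, and a
    vector of \<open>K\<close> outside all of them.\<close>
  have sep: "\<exists>P. (\<forall>a. P a \<in> carrier_mat l (?r * l)) \<and>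
      (\<forall>a\<in>J. \<forall>b\<in>J. \<forall>y\<in>carrier_vec l. P a *\<^sub>v (block l H b *\<^sub>v y) = (if a = b then y else 0\<^sub>v l))"
    if J: "J \<subseteq> {..<n}" "card J \<le> ?r" for J
  proof -
    obtain P where P: "\<And>a. P a \<in> carrier_mat l (?r * l)"
      "\<And>a b. a \<in> J \<Longrightarrow> b \<in> J \<Longrightarrow> P a * block l H b = (if a = b then 1\<^sub>m l else 0\<^sub>m l l)"
      using mds_separating_matrices[OF H mds l J] by blast
    have "P a *\<^sub>v (block l H b *\<^sub>v y) = (if a = b then y else 0\<^sub>v l)"
      if "a \<in> J" "b \<in> J" "y \<in> carrier_vec l" for a b y
    proof -
      have "b < n" using that J by auto
      then have "P a *\<^sub>v (block l H b *\<^sub>v y) = (P a * block l H b) *\<^sub>v y"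
        using assoc_mult_mat_vec[OF P(1) bc that(3)] by simp
      also have "\<dots> = (if a = b then y else 0\<^sub>v l)"
        using P(2)[OF that(1,2)] that(3) by auto
      finally show ?thesis .
    qed
    then show ?thesis using P(1) by blast
  qed
  \<comment> \<open>The nodes may coincide, so this serves for pairs as well. The assumption r \<ge>
    3 is what admits triples.\<close>
  have card3: "card {a, b, c} \<le> ?r" for a b c :: nat
    using r card_insert_le_m1[of 3 "{b, c}" a] card_insert_le_m1[of 2 "{c}" b] by simp
  have inj: "inj_on ((*\<^sub>v) (block l H j)) (W j)" if j: "j < n" for j
  proof -
    obtain P where "\<forall>y\<in>carrier_vec l. P j *\<^sub>v (block l H j *\<^sub>v y) = y"
      using sep[of "{j}"] j r by fastforce
    then show ?thesis using W[OF j] by (metis inj_onI)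
  qed
  have M0: "M *\<^sub>v 0\<^sub>v (?r * l) = 0\<^sub>v l" using Mc by auto
  have b0: "block l H j *\<^sub>v 0\<^sub>v l = 0\<^sub>v (?r * l)" if "j < n" for j
    using bc[OF that] by auto
  have W0: "0\<^sub>v l \<in> W j" if "j < n" for j
    by (simp add: W[OF that] b0[OF that] M0)
  have nonzero: "block l H j *\<^sub>v y \<noteq> 0\<^sub>v (?r * l)" if j: "j < n" and y: "y \<in> W j - {0\<^sub>v l}" for j y
    using inj[OF j] y b0[OF j] W0[OF j] by (metis DiffD1 DiffD2 inj_onD singletonI)
  have EK: "E j \<subseteq> K - {0\<^sub>v (?r * l)}" if j: "j < n" for j
  proof
    fix x assume "x \<in> E j"
    then obtain y where y: "y \<in> W j - {0\<^sub>v l}" and x: "x = block l H j *\<^sub>v y"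
      unfolding E_def by blast
    have "y \<in> carrier_vec l" "M *\<^sub>v x = 0\<^sub>v l" using y W[OF j] unfolding x by blast+
    then have "x \<in> K" unfolding K x using mult_mat_vec_carrier[OF bc[OF j]] by blast
    then show "x \<in> K - {0\<^sub>v (?r * l)}" using nonzero[OF j y] x by simp
  qed
  have finE: "finite (E j)" if "j < n" for j
    using finW[OF that] by (simp add: E_def)
  have cardE: "card (E j) = card (W j) - 1" if j: "j < n" for j
  proof -
    have "inj_on ((*\<^sub>v) (block l H j)) (W j - {0\<^sub>v l})"
      using inj[OF j] by (rule inj_on_subset) auto
    then show ?thesis
      unfolding E_def using W0[OF j] by (simp add: card_image card_Diff_singleton)
  qed
  have disj: "E a \<inter> E b = {}" if ab: "a < n" "b < n" "a \<noteq> b" for a b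
  proof -
    obtain P where P: "\<forall>a'\<in>{a, b}. \<forall>b'\<in>{a, b}. \<forall>y\<in>carrier_vec l.
        P a' *\<^sub>v (block l H b' *\<^sub>v y) = (if a' = b' then y else 0\<^sub>v l)"
      using sep[of "{a, b}"] card3[of a b b] ab(1,2) by auto
    show ?thesis
    proof (rule ccontr)
      assume "E a \<inter> E b \<noteq> {}"
      then obtain y z where yz: "y \<in> W a - {0\<^sub>v l}" "z \<in> W b - {0\<^sub>v l}"
        "block l H a *\<^sub>v y = block l H b *\<^sub>v z" unfolding E_def by auto
      then have yc: "y \<in> carrier_vec l" "z \<in> carrier_vec l" using W ab by blast+
      have "y = P a *\<^sub>v (block l H a *\<^sub>v y)" using P yc by simp
      also have "\<dots> = 0\<^sub>v l" unfolding yz(3) using P yc ab by simp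
      finally show False using yz by simp
    qed
  qed
  have qd: "q ^ d j \<le> card (W j)" if j: "j \<in> ?N" for j
  proof (cases "m j \<le> l")
    case True
    then have "q ^ l = q ^ m j * q ^ d j" by (simp add: d_def flip: power_add)
    then show ?thesis using m[of j] j q by (simp add: W_def)
  next
    \<comment> \<open>Here \<open>d j\<close> is 0, and it remains to see that \<open>W j\<close> is
      nonempty; this follows because the right-hand side in \<open>m\<close> is positive.\<close>
    case False
    have "q ^ m j * card (W j) > 0"
      using m[of j] j q by (metis DiffE W_def gr0I insertCI le_zero_eq lessThan_iff
          not_numeral_le_zero power_eq_0_iff)
    then show ?thesis using False by (simp add: d_def)
  qed
  have dE: "real (d j) * (real q - 1) \<le> real (card (E j))" if j: "j \<in> ?N" for j
  proof -
    have "1 \<le> q ^ d j" using q by simp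
    then have "q ^ d j - 1 \<le> card (E j)" "real (q ^ d j - 1) = real q ^ d j - 1"
      using qd[OF j] cardE[of j] j by (auto simp: of_nat_diff)
    then show ?thesis using power_ge_linear[OF q, of "d j"] by linarith
  qed
  have main: "(\<Sum>j\<in>?N. real (d j)) * (real q - 1) < real q ^ ((?r - 1) * l) - 1"
  proof (cases "\<exists>a\<in>?N. \<exists>b\<in>?N. a \<noteq> b \<and> E a \<noteq> {} \<and> E b \<noteq> {}")
    case True
    then obtain a b where ab: "a < n" "b < n" "a \<noteq> b" "E a \<noteq> {}" "E b \<noteq> {}" by auto
    then obtain y z where y: "y \<in> W a - {0\<^sub>v l}" and z: "z \<in> W b - {0\<^sub>v l}" unfolding E_def by blast
    let ?x = "block l H a *\<^sub>v y + block l H b *\<^sub>v z"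
    have yc: "y \<in> carrier_vec l" "z \<in> carrier_vec l" using y z ab W by blast+
    have xyc: "block l H a *\<^sub>v y \<in> carrier_vec (?r * l)" "block l H b *\<^sub>v z \<in> carrier_vec (?r * l)"
      using mult_mat_vec_carrier[OF bc] ab yc by blast+
    have "M *\<^sub>v (block l H a *\<^sub>v y) = 0\<^sub>v l" "M *\<^sub>v (block l H b *\<^sub>v z) = 0\<^sub>v l"
      using y z ab W by blast+
    then have xK: "?x \<in> K"
      using mult_add_distrib_mat_vec[OF Mc xyc] add_carrier_vec[OF xyc] unfolding K by simp
    \<comment> \<open>Choose a node among \<open>a\<close> and \<open>b\<close> different from
      \<open>c\<close>. Its separating matrix returns the nonzero vector \<open>y\<close> or
      \<open>z\<close> on \<open>?x\<close>, but zero on H_c w.\<close>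
    have notin: False if cw: "c < n" "w \<in> carrier_vec l" "?x = block l H c *\<^sub>v w" for c w
    proof -
      obtain P where Pc: "\<And>a. P a \<in> carrier_mat l (?r * l)" and P: "\<forall>a'\<in>{a, b, c}. \<forall>b'\<in>{a, b, c}.
          \<forall>y\<in>carrier_vec l. P a' *\<^sub>v (block l H b' *\<^sub>v y) = (if a' = b' then y else 0\<^sub>v l)"
        using sep[of "{a, b, c}"] card3[of a b c] ab(1,2) cw(1) by blast
      have dist: "P u *\<^sub>v ?x = P u *\<^sub>v (block l H a *\<^sub>v y) + P u *\<^sub>v (block l H b *\<^sub>v z)" for u
        using mult_add_distrib_mat_vec[OF Pc xyc] .
      show False
      proof (cases "c = a")
        case True
        have "z = P b *\<^sub>v ?x" unfolding dist using P ab(3) yc by simp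
        also have "\<dots> = 0\<^sub>v l" unfolding cw(3) using P ab(3) cw(2) True by simp
        finally show False using z by simp
      next
        case False
        have "y = P a *\<^sub>v ?x" unfolding dist using P ab(3) yc by simp
        also have "\<dots> = 0\<^sub>v l" unfolding cw(3) using P cw(2) False by simp
        finally show False using y by simp
      qed
    qed
    \<comment> \<open>The zero vector is H_a applied to zero, so it is excluded by
      \<open>notin\<close> as well.\<close>
    have "?x \<noteq> 0\<^sub>v (?r * l)"
    proof
      assume "?x = 0\<^sub>v (?r * l)"
      then have "?x = block l H a *\<^sub>v 0\<^sub>v l" using b0[OF ab(1)] by simp
      then show False using notin[OF ab(1) zero_carrier_vec] by blast
    qed
    moreover have "?x \<notin> (\<Union>j\<in>?N. E j)" using notin W unfolding E_def by blast
    ultimately have "(\<Union>j\<in>?N. E j) \<subset> K - {0\<^sub>v (?r * l)}" using xK EK by blast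
    then have "card (\<Union>j\<in>?N. E j) < card (K - {0\<^sub>v (?r * l)})"
      using finK by (intro psubset_card_mono) auto
    also have "\<dots> = q ^ ((?r - 1) * l) - 1"
      using M0 by (subst card_Diff_singleton) (simp_all add: cardK K)
    also have "card (\<Union>j\<in>?N. E j) = (\<Sum>j\<in>?N. card (E j))"
      using finE disj by (intro card_UN_disjoint) auto
    finally have "real (\<Sum>j\<in>?N. card (E j)) < real (q ^ ((?r - 1) * l) - 1)"
      by (simp only: of_nat_less_iff)
    moreover have "real (q ^ ((?r - 1) * l) - 1) = real q ^ ((?r - 1) * l) - 1"
      using q by (simp add: of_nat_diff)
    moreover have "(\<Sum>j\<in>?N. real (d j)) * (real q - 1) \<le> real (\<Sum>j\<in>?N. card (E j))"
      unfolding sum_distrib_right of_nat_sum using dE by (intro sum_mono)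
    ultimately show ?thesis by linarith
  next
    case False
    \<comment> \<open>At most one \<open>E j\<close> is nonempty, and by \<open>dE\<close> an empty
      one forces \<open>d j = 0\<close>. Hence the sum has at most one nonzero term, itself at most
      \<open>l\<close>.\<close>
    have "(\<Sum>j\<in>?N. real (d j)) \<le> real l"
    proof (cases "\<exists>a\<in>?N. E a \<noteq> {}")
      case True
      then obtain a where a: "a \<in> ?N" "E a \<noteq> {}" by blast
      have "real (d j) = 0" if "j \<in> ?N - {a}" for j
      proof -
        have "E j = {}" using False a that by blast
        then show ?thesis using dE[of j] that q by (auto simp: mult_le_0_iff)
      qed
      then have "(\<Sum>j\<in>?N. real (d j)) = real (d a)"
        using a by (simp add: sum.remove[of ?N a])
      then show ?thesis by (simp add: d_def)
    next
      case none: False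
      have "real (d j) = 0" if "j \<in> ?N" for j
        using none dE[of j] that q by (auto simp: mult_le_0_iff)
      then show ?thesis by simp
    qed
    then have "(\<Sum>j\<in>?N. real (d j)) * (real q - 1) \<le> real l * (real q - 1)"
      using q by (intro mult_right_mono) auto
    \<comment> \<open>Strictness comes from r - 1 \<ge> 2 and l > 0; then
      \<open>power_ge_linear\<close> is applied with exponent (r - 1) l.\<close>
    also have "\<dots> < real ((?r - 1) * l) * (real q - 1)"
      using q r l by (intro mult_strict_right_mono) auto
    also have "\<dots> \<le> real q ^ ((?r - 1) * l) - 1"
      by (rule power_ge_linear[OF q])
    finally show ?thesis .
  qed
  have "real l * (real n - 1) = (\<Sum>j\<in>?N. real l)" using i by simp
  also have "\<dots> \<le> (\<Sum>j\<in>?N. real (m j) + real (d j))"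
    by (intro sum_mono) (simp add: d_def)
  also have "\<dots> = real (\<Sum>j\<in>?N. m j) + (\<Sum>j\<in>?N. real (d j))" by (simp add: sum.distrib)
  finally have "real l * (real n - 1) \<le> real (\<Sum>j\<in>?N. m j) + (\<Sum>j\<in>?N. real (d j))" .
  moreover have "(\<Sum>j\<in>?N. real (d j)) < (real q ^ ((?r - 1) * l) - 1) / (real q - 1)"
    using main q by (simp add: pos_less_divide_eq)
  ultimately show ?thesis by linarith
qed

section \<open>From single repair matrices to minima, averages and maxima\<close>

text \<open>A separating matrix for the single node \<open>i\<close> satisfies M H_i = 1. Together
  with finiteness this ensures that the minima in \<open>beta\<close> and \<open>gamma\<close> are
  attained, whereas \<open>Min\<close> of the empty set would be unspecified.\<close>

lemma repair_matrices_nonempty: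
  fixes H :: "'a::field mat"
  assumes "H \<in> carrier_mat ((n - k) * l) (n * l)" and "mds n k l H"
    and "0 < l" and "k < n" and "i < n"
  shows "repair_matrices n k l H i \<noteq> {}"
proof -
  have "{i} \<subseteq> {..<n}" "card {i} \<le> n - k" using assms(4,5) by auto
  then obtain P where P: "\<And>a. P a \<in> carrier_mat l ((n - k) * l)"
    "\<And>a b. a \<in> {i} \<Longrightarrow> b \<in> {i} \<Longrightarrow> P a * block l H b = (if a = b then 1\<^sub>m l else 0\<^sub>m l l)"
    using mds_separating_matrices[OF assms(1,2,3), of "{i}"] by blast
  have "invertible_mat (1\<^sub>m l :: 'a mat)"
    unfolding invertible_mat_def inverts_mat_def by (auto intro!: exI[of _ "1\<^sub>m l"])
  then have "P i \<in> repair_matrices n k l H i"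
    using P by (simp add: repair_matrices_def)
  then show ?thesis by blast
qed

lemma finite_repair_matrices: "finite (repair_matrices n k l (H :: 'a::{field,finite} mat) i)"
  unfolding repair_matrices_def
  by (rule finite_subset[OF _ finite_carrier_mat[of l "(n - k) * l"]]) auto

lemma less_average:
  fixes f :: "nat \<Rightarrow> nat" and c :: real
  assumes "0 < n" and "\<And>i. i < n \<Longrightarrow> c < real (f i)"
  shows "c < (\<Sum>i<n. real (f i)) / real n"
proof -
  have "(\<Sum>i<n. c) < (\<Sum>i<n. real (f i))"
    using assms by (intro sum_strict_mono) auto
  then show ?thesis using assms(1) by (simp add: pos_less_divide_eq mult.commute)
qed

lemma less_Max:
  fixes f :: "nat \<Rightarrow> nat" and c :: real
  assumes "0 < n" and "\<And>i. i < n \<Longrightarrow> c < real (f i)"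
  shows "c < real (Max (f ` {..<n}))"
proof -
  have "f 0 \<le> Max (f ` {..<n})" using assms(1) by (intro Max_ge) auto
  then show ?thesis using assms(2)[OF assms(1)] by linarith
qed

theorem theorem1p2:
  fixes C :: "'a::{field,finite} vec set" and H :: "'a mat"
    and n k l r q :: nat and bound :: real
  assumes "q = CARD('a)"
    and "0 < k" and "k < n" and "r = n - k" and "3 \<le> r" and "2 \<le> l"
    and "array_code n k l C" and "parity_check_matrix n k l C H" and "mds n k l H"
    and "bound = real l * (real n - 1) - (real q ^ ((r - 1) * l) - 1) / (real q - 1)"
  shows "bound < beta_avg n k l H \<and> bound < real (beta_max n k l H) \<and>
         bound < gamma_avg n k l H \<and> bound < real (gamma_max n k l H)"
proof -
  have H: "H \<in> carrier_mat ((n - k) * l) (n * l)"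
    using assms(8) by (simp add: parity_check_matrix_def)
  have l: "0 < l" and r: "3 \<le> n - k" using assms by auto
  have MHc: "M * block l H j \<in> carrier_mat l l"
    if "M \<in> repair_matrices n k l H i" "j < n" for M i j
    using that block_carrier[OF H that(2) l] by (auto simp: repair_matrices_def)
  \<comment> \<open>This is the hypothesis of \<open>repair_cost_lower_bound\<close> on the costs,
    with the rank of M H_j as the cost of node \<open>j\<close>.\<close>
  note kernel = power_le_power_rank_mult_card_kernel[OF MHc, folded assms(1)]
  have BW: "bound < real (BW n l H i M)" if "i < n" "M \<in> repair_matrices n k l H i" for i M
    using repair_cost_lower_bound[OF H \<open>mds n k l H\<close> r l that,
        of "\<lambda>j. vec_space.rank l (M * block l H j)"] kernel[OF that(2)] assms
    by (simp add: BW_def)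
  have IO: "bound < real (IO n l H i M)" if "i < n" "M \<in> repair_matrices n k l H i" for i M
  proof -
    have "BW n l H i M \<le> IO n l H i M"
      unfolding BW_def IO_def using vec_space.rank_le_nz MHc[OF that(2)] by (intro sum_mono) blast
    then show ?thesis using BW[OF that] by linarith
  qed
  have ne: "repair_matrices n k l H i \<noteq> {}" if "i < n" for i
    using repair_matrices_nonempty[OF H \<open>mds n k l H\<close> l \<open>k < n\<close> that] .
  \<comment> \<open>The minimum is the bandwidth of some repair matrix, so the strict bound passes
    to it. Since it then holds at every node, it passes to the average and to the maximum as
    well.\<close>
  have beta: "bound < real (beta n k l H i)" if "i < n" for i
  proof -
    have "beta n k l H i \<in> BW n l H i ` repair_matrices n k l H i"
      unfolding beta_def using ne[OF that] by (intro Min_in finite_imageI finite_repair_matrices) simp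
    then show ?thesis using BW[OF that] by auto
  qed
  have gamma: "bound < real (gamma n k l H i)" if "i < n" for i
  proof -
    have "gamma n k l H i \<in> IO n l H i ` repair_matrices n k l H i"
      unfolding gamma_def using ne[OF that] by (intro Min_in finite_imageI finite_repair_matrices) simp
    then show ?thesis using IO[OF that] by auto
  qed
  have n: "0 < n" using \<open>k < n\<close> by simp
  show ?thesis
    unfolding beta_avg_def beta_max_def gamma_avg_def gamma_max_def
    using n beta gamma by (intro conjI less_average less_Max)
qed

end
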